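(* There exists an absolute positive constant $K$ such that for every $n \in \mathbb{N}$, every integer $k \ge 2$, every $\alpha > 0$, every $p \in \Delta^{k-1}_{\alpha}$ and every positive integer $m$, $$\left\|Z_{n,k,p} - \mathbb{E}[Z_{n,k,p}]\right\|_m \le K\left(\sqrt{k m \log^4\left(\frac{k}{\alpha}\right)} + m\right).$$
   Context: $\mathbb{N} = \{1,2,\dots\}$; all logarithms are natural and $\log^4(x)$ means $(\log x)^4$. For a random variable $X$ and a positive integer $m$, $\|X\|_m = (\mathbb{E}|X|^m)^{1/m}$. For an integer $k \ge 2$, $\Delta^{k-1} = \{p = (p_1,\dots,p_k) : p_i \ge 0, \sum_{i=1}^k p_i = 1\}$ is the probability simplex, and for $\alpha > 0$, $\Delta^{k-1}_{\alpha} = \{p \in \Delta^{k-1} : \min_{1\le i \le k} p_i \ge \alpha\}$. For $n \in \mathbb{N}$ let $(X_1,\dots,X_k) \sim \mathrm{Multinomial}(n,p)$ and $\widehat{p}_{n,k} = (\widehat p_1,\dots,\widehat p_k) = (X_1/n,\dots,X_k/n)$. The relative entropy is $D(\widehat{p}_{n,k}\|p) = \sum_{i=1}^k \widehat p_i \log(\widehat p_i/p_i)$, with terms having $\widehat p_i = 0$ equal to $0$, and $Z_{n,k,p} := 2n D(\widehat{p}_{n,k}\|p)$. *)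

theory Defs
  imports "HOL-Probability.Probability"
begin

(* A vector (p_1, ..., p_k) is a function on nat of which only the values on {1..k} matter;
   the length k has to be a variable since the constant in the theorem is uniform in k. *)

definition prob_simplex :: "nat \<Rightarrow> (nat \<Rightarrow> real) set" where
  "prob_simplex k = {p. (\<forall>i\<in>{1..k}. p i \<ge> 0) \<and> (\<Sum>i=1..k. p i) = 1}"

definition prob_simplex_ge :: "nat \<Rightarrow> real \<Rightarrow> (nat \<Rightarrow> real) set" where
  "prob_simplex_ge k \<alpha> = {p \<in> prob_simplex k. Min (p ` {1..k}) \<ge> \<alpha>}"

definition categorical_pmf :: "nat \<Rightarrow> (nat \<Rightarrow> real) \<Rightarrow> nat pmf" where
  "categorical_pmf k p = embed_pmf (\<lambda>i. if i \<in> {1..k} then p i else 0)"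

(* The law of the category counts of n independent draws; the closed form of its mass function
   is pmf_multinomial below. *)
definition multinomial_pmf :: "nat \<Rightarrow> nat \<Rightarrow> (nat \<Rightarrow> real) \<Rightarrow> (nat \<Rightarrow> nat) pmf" where
  "multinomial_pmf n k p = map_pmf count_list (replicate_pmf n (categorical_pmf k p))"

definition empirical :: "nat \<Rightarrow> (nat \<Rightarrow> nat) \<Rightarrow> nat \<Rightarrow> real" where
  "empirical n x = (\<lambda>i. real (x i) / real n)"

(* Terms with q i = 0 vanish, whatever the value of ln (0 / p i). *)
definition rel_entropy :: "nat \<Rightarrow> (nat \<Rightarrow> real) \<Rightarrow> (nat \<Rightarrow> real) \<Rightarrow> real" where
  "rel_entropy k q p = (\<Sum>i=1..k. q i * ln (q i / p i))"

(* A random variable on the space of count vectors, to be taken under multinomial_pmf n k p. *)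
definition Z :: "nat \<Rightarrow> nat \<Rightarrow> (nat \<Rightarrow> real) \<Rightarrow> (nat \<Rightarrow> nat) \<Rightarrow> real" where
  "Z n k p x = 2 * real n * rel_entropy k (empirical n x) p"

definition moment_norm :: "'a measure \<Rightarrow> nat \<Rightarrow> ('a \<Rightarrow> real) \<Rightarrow> real" where
  "moment_norm M m X = (\<integral>\<omega>. \<bar>X \<omega>\<bar> ^ m \<partial>M) powr (1 / real m)"

lemma pmf_categorical:
  assumes "p \<in> prob_simplex k"
  shows "pmf (categorical_pmf k p) i = (if i \<in> {1..k} then p i else 0)"
proof -
  let ?f = "\<lambda>i. if i \<in> {1..k} then p i else 0"
  have "(\<integral>\<^sup>+ x. ennreal (?f x) \<partial>count_space UNIV) = (\<Sum>x\<in>{1..k}. ennreal (?f x))"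
    by (intro nn_integral_count_space') auto
  also have "\<dots> = ennreal (\<Sum>x\<in>{1..k}. ?f x)"
    using assms by (subst sum_ennreal) (auto simp: prob_simplex_def)
  also have "(\<Sum>x\<in>{1..k}. ?f x) = 1"
    using assms by (simp add: prob_simplex_def)
  finally have "(\<integral>\<^sup>+ x. ennreal (?f x) \<partial>count_space UNIV) = 1"
    by simp
  then show ?thesis
    unfolding categorical_pmf_def
    using assms by (subst pmf_embed_pmf) (auto simp: prob_simplex_def)
qed

lemma multinomial_pmf_0: "multinomial_pmf 0 k p = return_pmf (\<lambda>_. 0)"
  by (simp add: multinomial_pmf_def fun_eq_iff map_pmf_def bind_return_pmf)

lemma multinomial_pmf_Suc:
  "multinomial_pmf (Suc n) k p =
     bind_pmf (categorical_pmf k p)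
       (\<lambda>i. map_pmf (\<lambda>x. x(i := Suc (x i))) (multinomial_pmf n k p))"
proof -
  have *: "count_list (i # xs) = (count_list xs)(i := Suc (count_list xs i))" for i :: nat and xs
    by (auto simp: fun_eq_iff)
  show ?thesis
    by (simp only: multinomial_pmf_def replicate_pmf.simps map_bind_pmf map_return_pmf
          map_pmf_comp * flip: map_pmf_def)
qed

lemma pmf_map_incr:
  fixes M :: "(nat \<Rightarrow> nat) pmf"
  shows "pmf (map_pmf (\<lambda>x. x(i := Suc (x i))) M) y =
    (if y i = 0 then 0 else pmf M (y(i := y i - 1)))"
proof (cases "y i = 0")
  case True
  have "y \<notin> set_pmf (map_pmf (\<lambda>x. x(i := Suc (x i))) M)"
    using True by auto
  then have "pmf (map_pmf (\<lambda>x. x(i := Suc (x i))) M) y = 0"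
    by (simp only: set_pmf_iff not_not)
  then show ?thesis
    using True by simp
next
  case False
  have inj: "inj (\<lambda>x::nat \<Rightarrow> nat. x(i := Suc (x i)))"
  proof (rule injI)
    fix x y :: "nat \<Rightarrow> nat"
    assume eq: "x(i := Suc (x i)) = y(i := Suc (y i))"
    show "x = y"
    proof
      fix j
      show "x j = y j"
        using fun_cong[OF eq, of j] by (simp split: if_splits)
    qed
  qed
  have "y = (\<lambda>x. x(i := Suc (x i))) (y(i := y i - 1))"
    using False by auto
  then show ?thesis
    using False pmf_map_inj'[OF inj, of M "y(i := y i - 1)"] by simp
qed

lemma pmf_multinomial:
  assumes p: "p \<in> prob_simplex k"
  shows "pmf (multinomial_pmf n k p) x =
    (if (\<Sum>i=1..k. x i) = n \<and> (\<forall>i. i \<notin> {1..k} \<longrightarrow> x i = 0)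
     then fact n / (\<Prod>i=1..k. fact (x i)) * (\<Prod>i=1..k. p i ^ x i) else 0)"
proof (induction n arbitrary: x)
  case 0
  have "x = (\<lambda>_. 0) \<longleftrightarrow> (\<Sum>i=1..k. x i) = 0 \<and> (\<forall>i. i \<notin> {1..k} \<longrightarrow> x i = 0)"
    by (auto simp: fun_eq_iff)
  then show ?case
    by (auto simp: multinomial_pmf_0 pmf_return indicator_def)
next
  case (Suc n)
  let ?C = "\<forall>i. i \<notin> {1..k} \<longrightarrow> x i = 0"
  have "pmf (multinomial_pmf (Suc n) k p) x =
    measure_pmf.expectation (categorical_pmf k p)
      (\<lambda>i. if x i = 0 then 0 else pmf (multinomial_pmf n k p) (x(i := x i - 1)))"
    by (simp add: multinomial_pmf_Suc pmf_bind pmf_map_incr)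
  also have "\<dots> = (\<Sum>i=1..k. p i *
      (if x i = 0 then 0 else pmf (multinomial_pmf n k p) (x(i := x i - 1))))"
    using p by (subst integral_measure_pmf[of "{1..k}"])
      (auto simp: pmf_categorical set_pmf_iff split: if_splits)
  finally have step: "pmf (multinomial_pmf (Suc n) k p) x = (\<Sum>i=1..k. p i *
      (if x i = 0 then 0 else pmf (multinomial_pmf n k p) (x(i := x i - 1))))" .
  have sums: "(\<Sum>j=1..k. x j) = Suc (\<Sum>j=1..k. (x(i := x i - 1)) j)"
    if "i \<in> {1..k}" "x i \<noteq> 0" for i
  proof -
    have "(\<Sum>j=1..k. x j) = x i + (\<Sum>j\<in>{1..k}-{i}. x j)"
      using that by (simp add: sum.remove)
    moreover have "(\<Sum>j=1..k. (x(i := x i - 1)) j) = (x i - 1) + (\<Sum>j\<in>{1..k}-{i}. x j)"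
      using that by (subst sum.remove[of _ i]) auto
    ultimately show ?thesis using that by simp
  qed
  have outside: "(\<forall>j. j \<notin> {1..k} \<longrightarrow> (x(i := x i - 1)) j = 0) \<longleftrightarrow> ?C"
    if "i \<in> {1..k}" for i
    using that by (metis fun_upd_other)
  show ?case
  proof (cases "(\<Sum>i=1..k. x i) = Suc n \<and> ?C")
    case False
    have "pmf (multinomial_pmf n k p) (x(i := x i - 1)) = 0"
      if "i \<in> {1..k}" "x i \<noteq> 0" for i
      using False sums[OF that] outside[OF that(1)] by (subst Suc.IH) auto
    then have "pmf (multinomial_pmf (Suc n) k p) x = 0"
      unfolding step by (intro sum.neutral) auto
    then show ?thesis
      unfolding if_not_P[OF False] .
  next
    case True
    let ?F = "(\<Prod>i=1..k. fact (x i)) :: real" and ?P = "\<Prod>i=1..k. p i ^ x i"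
    have "p i * (if x i = 0 then 0 else pmf (multinomial_pmf n k p) (x(i := x i - 1))) =
        real (x i) * (fact n / ?F * ?P)" if i: "i \<in> {1..k}" for i
    proof (cases "x i = 0")
      case False
      then obtain c where c: "x i = Suc c"
        by (cases "x i") auto
      let ?y = "x(i := x i - 1)"
      have IH: "pmf (multinomial_pmf n k p) ?y =
          fact n / (\<Prod>j=1..k. fact (?y j)) * (\<Prod>j=1..k. p j ^ ?y j)"
        using True sums[OF i False] outside[OF i] by (subst Suc.IH) auto
      have F: "?F = real (x i) * (\<Prod>j=1..k. fact (?y j))"
        using i by (subst (1 2) prod.remove[of _ i]) (auto simp: c)
      have P: "?P = p i * (\<Prod>j=1..k. p j ^ ?y j)"
        using i by (subst (1 2) prod.remove[of _ i]) (auto simp: c)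
      show ?thesis
        using False by (simp only: IH F P if_False) (simp add: field_simps)
    qed simp
    then have "pmf (multinomial_pmf (Suc n) k p) x =
        (\<Sum>i=1..k. real (x i) * (fact n / ?F * ?P))"
      unfolding step by (intro sum.cong) auto
    also have "\<dots> = real (\<Sum>i=1..k. x i) * (fact n / ?F * ?P)"
      by (simp only: sum_distrib_right of_nat_sum)
    also have "\<dots> = fact (Suc n) / ?F * ?P"
      using True by simp
    finally show ?thesis
      unfolding if_P[OF True] .
  qed
qed

end

theory Submission
  imports Defs
begin

text \<open>
  Write \<open>\<mu> i = n * p i\<close> for the mean of the \<open>i\<close>-th count. Since both the counts and the means
  add up to \<open>n\<close>, linear terms may be inserted into the relative entropy:
  \<open>Z = 2 * (\<Sum>i. \<phi> i (X i))\<close> with \<open>\<phi> i (x) = x * ln (x / \<mu> i) - x + \<mu> i\<close>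
  (lemma \<open>Z_eq_sum_poisson_rate\<close>). Each \<open>\<phi> i\<close> is nonnegative and convex with its zero at
  \<open>\<mu> i\<close>, so it splits into an increasing part, living above the mean, and a decreasing part,
  living below it.

  Two facts then carry the proof. The first is negative dependence: for nonnegative functions
  that are all increasing, or all decreasing, the expectation of \<open>\<Prod>i. g i (X i)\<close> is at most the
  product of the expectations (\<open>multinomial_expectation_prod_le\<close>). Exponentials of the
  increasing parts are of this kind, whatever the sign of the exponent, and so are those of the
  decreasing parts. Each of the two sums therefore has a moment generating function bounded as if
  the counts were independent.

  The second is that \<open>\<phi> i\<close> is precisely the exponent in the Chernoff bound for \<open>X i\<close>. Hence
  each part exceeds \<open>t\<close> with probability at most \<open>exp (- t)\<close> (\<open>upper_rate_tail\<close>,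
  \<open>lower_rate_tail\<close>), uniformly in all parameters, and once centred it has moment generating
  function at most \<open>exp (C * s\<^sup>2)\<close> near the origin (\<open>centred_mgf_le\<close>).

  Multiplying over the categories and recombining the two parts by the arithmetic-geometric mean
  inequality bounds the moment generating function of the centred \<open>Z\<close> by \<open>exp (C' * k * s\<^sup>2)\<close>
  for \<open>\<bar>s\<bar> \<le> 1 / 32\<close> (\<open>Z_centred_mgf_le\<close>). Choosing \<open>s\<close> of order \<open>min 1 (sqrt (m / k))\<close>
  turns this into the moment bound \<open>K * (sqrt (k * m) + m)\<close> (\<open>moment_norm_le_of_mgf\<close>), and
  the logarithmic factor only enlarges the right-hand side, because \<open>ln (k / \<alpha>) \<ge> 1\<close>.
\<close>

section \<open>The multinomial law one trial at a time\<close>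

text \<open>Finite support makes every function integrable, so that no integrability side condition needs
  an argument of its own below.\<close>

lemma finite_set_pmf_multinomial:
  assumes p: "p \<in> prob_simplex k"
  shows "finite (set_pmf (multinomial_pmf n k p))"
proof (induction n)
  case (Suc n)
  have "set_pmf (categorical_pmf k p) \<subseteq> {1..k}"
    using p by (auto simp: set_pmf_iff pmf_categorical split: if_splits)
  then have "finite (set_pmf (categorical_pmf k p))"
    by (rule finite_subset) simp
  then show ?case
    using Suc by (simp add: multinomial_pmf_Suc)
qed (simp add: multinomial_pmf_0)

lemma expectation_multinomial_Suc:
  fixes F :: "(nat \<Rightarrow> nat) \<Rightarrow> real"
  assumes p: "p \<in> prob_simplex k"
  shows "measure_pmf.expectation (multinomial_pmf (Suc n) k p) F =
    (\<Sum>j=1..k. p j * measure_pmf.expectation (multinomial_pmf n k p) (\<lambda>x. F (x(j := Suc (x j)))))"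
proof -
  have sub: "set_pmf (categorical_pmf k p) \<subseteq> {1..k}"
    using p by (auto simp: set_pmf_iff pmf_categorical split: if_splits)
  have "measure_pmf.expectation (multinomial_pmf (Suc n) k p) F =
    (\<Sum>j\<in>{1..k}. pmf (categorical_pmf k p) j *\<^sub>R
       measure_pmf.expectation (map_pmf (\<lambda>x. x(j := Suc (x j))) (multinomial_pmf n k p)) F)"
    unfolding multinomial_pmf_Suc
    by (rule pmf_expectation_bind) (use sub finite_set_pmf_multinomial[OF p] in auto)
  then show ?thesis
    using p by (simp add: pmf_categorical)
qed

lemma sum_counts_multinomial:
  assumes p: "p \<in> prob_simplex k" and x: "x \<in> set_pmf (multinomial_pmf n k p)"
  shows "(\<Sum>i=1..k. x i) = n"
  using x by (auto simp: set_pmf_iff pmf_multinomial[OF p] split: if_splits)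

section \<open>Negative dependence of the counts\<close>

text \<open>A Weierstrass-type inequality: the left-hand side is the part of the expanded product of
  degree at most one in \<open>d\<close>. When a factor is added, the only new term left out is the product
  of two first-order terms, which is nonnegative because the \<open>d i\<close> have a common sign.\<close>

lemma prod_linearization_le:
  fixes a d p :: "'a \<Rightarrow> real"
  assumes "finite S"
    and a: "\<And>i. i \<in> S \<Longrightarrow> 0 \<le> a i"
    and p: "\<And>i. i \<in> S \<Longrightarrow> 0 \<le> p i"
    and nn: "\<And>i. i \<in> S \<Longrightarrow> 0 \<le> a i + p i * d i"
    and sgn: "(\<forall>i\<in>S. 0 \<le> d i) \<or> (\<forall>i\<in>S. d i \<le> 0)"
  shows "(\<Prod>i\<in>S. a i) + (\<Sum>j\<in>S. p j * d j * (\<Prod>i\<in>S-{j}. a i)) \<le> (\<Prod>i\<in>S. a i + p i * d i)"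
  using assms
proof (induction S rule: finite_induct)
  case (insert t S)
  let ?L = "\<Sum>j\<in>S. p j * d j * (\<Prod>i\<in>S-{j}. a i)"
  have IH: "(\<Prod>i\<in>S. a i) + ?L \<le> (\<Prod>i\<in>S. a i + p i * d i)"
    using insert by auto
  have rest: "(\<Prod>i\<in>insert t S - {j}. a i) = a t * (\<Prod>i\<in>S-{j}. a i)" if "j \<in> S" for j
  proof -
    have "insert t S - {j} = insert t (S - {j})" using that insert.hyps by auto
    then show ?thesis using insert.hyps by simp
  qed
  have cross: "0 \<le> ?L * (p t * d t)"
    using insert.prems(4)
  proof
    assume "\<forall>i\<in>insert t S. 0 \<le> d i"
    then show ?thesis using insert.prems
      by (intro mult_nonneg_nonneg sum_nonneg prod_nonneg) auto
  next
    assume "\<forall>i\<in>insert t S. d i \<le> 0"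
    then show ?thesis using insert.prems
      by (intro mult_nonpos_nonpos sum_nonpos mult_nonpos_nonneg mult_nonneg_nonpos prod_nonneg) auto
  qed
  have "(\<Sum>j\<in>insert t S. p j * d j * (\<Prod>i\<in>insert t S-{j}. a i)) =
      p t * d t * (\<Prod>i\<in>S. a i) + (\<Sum>j\<in>S. p j * d j * (a t * (\<Prod>i\<in>S-{j}. a i)))"
    using insert.hyps rest by (simp add: insert_Diff_if cong: sum.cong)
  also have "\<dots> = p t * d t * (\<Prod>i\<in>S. a i) + a t * ?L"
    by (simp add: sum_distrib_left mult_ac)
  finally have "(\<Prod>i\<in>insert t S. a i) + (\<Sum>j\<in>insert t S. p j * d j * (\<Prod>i\<in>insert t S-{j}. a i)) =
      a t * (\<Prod>i\<in>S. a i) + (p t * d t * (\<Prod>i\<in>S. a i) + a t * ?L)"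
    using insert.hyps by simp
  also have "\<dots> \<le> ((\<Prod>i\<in>S. a i) + ?L) * (a t + p t * d t)"
    using cross by (simp add: algebra_simps)
  also have "\<dots> \<le> (\<Prod>i\<in>S. a i + p i * d i) * (a t + p t * d t)"
    using IH insert.prems(3)[of t] by (intro mult_right_mono) auto
  finally show ?case
    using insert.hyps by (simp add: mult.commute)
qed simp

text \<open>Negative dependence for a single trial: \<open>b i\<close> and \<open>a i\<close> are the values of the
  \<open>i\<close>-th function when category \<open>i\<close> is hit and when it is missed. As exactly one category is hit,
  the joint expectation is affine in the increments \<open>b i - a i\<close>; it is the linearization of the
  product of the separate expectations.\<close>

lemma single_trial_prod_le:
  fixes a b p :: "nat \<Rightarrow> real"
  assumes p: "p \<in> prob_simplex k"
    and a: "\<And>i. i \<in> {1..k} \<Longrightarrow> 0 \<le> a i" and b: "\<And>i. i \<in> {1..k} \<Longrightarrow> 0 \<le> b i"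
    and sgn: "(\<forall>i\<in>{1..k}. a i \<le> b i) \<or> (\<forall>i\<in>{1..k}. b i \<le> a i)"
  shows "(\<Sum>j=1..k. p j * (\<Prod>i=1..k. if i = j then b i else a i)) \<le>
    (\<Prod>i=1..k. p i * b i + (1 - p i) * a i)"
proof -
  have p0: "0 \<le> p i" if "i \<in> {1..k}" for i
    using p that by (auto simp: prob_simplex_def)
  have s1: "(\<Sum>i=1..k. p i) = 1" using p by (simp add: prob_simplex_def)
  have p1: "p i \<le> 1" if "i \<in> {1..k}" for i
    using member_le_sum[of i "{1..k}" p] that p0 s1 by auto
  have eq: "(\<Prod>i=1..k. if i = j then b i else a i) =
      (\<Prod>i=1..k. a i) + (b j - a j) * (\<Prod>i\<in>{1..k}-{j}. a i)" if j: "j \<in> {1..k}" for j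
  proof -
    have "(\<Prod>i=1..k. if i = j then b i else a i) =
        b j * (\<Prod>i\<in>{1..k}-{j}. if i = j then b i else a i)"
      using j by (subst prod.remove[of _ j]) auto
    also have "(\<Prod>i\<in>{1..k}-{j}. if i = j then b i else a i) = (\<Prod>i\<in>{1..k}-{j}. a i)"
      by (rule prod.cong) auto
    finally show ?thesis
      using j by (simp add: prod.remove[of _ j a] algebra_simps)
  qed
  have "(\<Sum>j=1..k. p j * (\<Prod>i=1..k. if i = j then b i else a i)) =
      (\<Sum>j=1..k. p j * (\<Prod>i=1..k. a i) + p j * (b j - a j) * (\<Prod>i\<in>{1..k}-{j}. a i))"
    by (intro sum.cong refl, subst eq, assumption, simp add: algebra_simps)
  also have "\<dots> = (\<Prod>i=1..k. a i) + (\<Sum>j=1..k. p j * (b j - a j) * (\<Prod>i\<in>{1..k}-{j}. a i))"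
    using s1 by (simp add: sum.distrib flip: sum_distrib_right)
  also have "\<dots> \<le> (\<Prod>i=1..k. a i + p i * (b i - a i))"
  proof (rule prod_linearization_le)
    fix i assume i: "i \<in> {1..k}"
    have "0 \<le> p i * b i + (1 - p i) * a i"
      using p0[OF i] p1[OF i] a[OF i] b[OF i] by simp
    then show "0 \<le> a i + p i * (b i - a i)" by (simp add: algebra_simps)
  qed (use a p0 sgn in auto)
  also have "\<dots> = (\<Prod>i=1..k. p i * b i + (1 - p i) * a i)"
    by (intro prod.cong refl) (simp add: algebra_simps)
  finally show ?thesis .
qed

lemma expectation_count_Suc:
  fixes g :: "nat \<Rightarrow> real"
  assumes p: "p \<in> prob_simplex k" and i: "i \<in> {1..k}"
  shows "measure_pmf.expectation (multinomial_pmf (Suc n) k p) (\<lambda>x. g (x i)) =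
    p i * measure_pmf.expectation (multinomial_pmf n k p) (\<lambda>x. g (Suc (x i))) +
    (1 - p i) * measure_pmf.expectation (multinomial_pmf n k p) (\<lambda>x. g (x i))"
proof -
  let ?E = "measure_pmf.expectation (multinomial_pmf n k p)"
  have "(\<Sum>j\<in>{1..k}-{i}. p j) = 1 - p i"
    using p i by (simp add: prob_simplex_def sum.remove[of _ i p])
  moreover have "(\<Sum>j\<in>{1..k}-{i}. p j * ?E (\<lambda>x. g ((x(j := Suc (x j))) i))) =
      (\<Sum>j\<in>{1..k}-{i}. p j) * ?E (\<lambda>x. g (x i))"
    by (simp add: sum_distrib_right)
  ultimately show ?thesis
    using i by (simp add: expectation_multinomial_Suc[OF p] sum.remove[of _ i])
qed

text \<open>Conditioning on the extra trial, the induction hypothesis applies to functions shifted by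
  one in the category that was hit. What remains is a product depending on that trial only, with
  factors that inherit the monotonicity of the \<open>g i\<close>, so the single-trial case finishes.\<close>

lemma multinomial_expectation_prod_le:
  fixes g :: "nat \<Rightarrow> nat \<Rightarrow> real"
  assumes p: "p \<in> prob_simplex k"
    and "\<And>i y. i \<in> {1..k} \<Longrightarrow> 0 \<le> g i y"
    and "(\<forall>i\<in>{1..k}. mono (g i)) \<or> (\<forall>i\<in>{1..k}. antimono (g i))"
  shows "measure_pmf.expectation (multinomial_pmf n k p) (\<lambda>x. \<Prod>i=1..k. g i (x i)) \<le>
    (\<Prod>i=1..k. measure_pmf.expectation (multinomial_pmf n k p) (\<lambda>x. g i (x i)))"
  using assms(2,3)
proof (induction n arbitrary: g)
  case 0
  then show ?case by (simp add: multinomial_pmf_0)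
next
  case (Suc n)
  let ?E = "measure_pmf.expectation (multinomial_pmf n k p)"
  note int = integrable_measure_pmf_finite[OF finite_set_pmf_multinomial[OF p]]
  have p0: "0 \<le> p i" if "i \<in> {1..k}" for i
    using p that by (auto simp: prob_simplex_def)
  have step: "?E (\<lambda>x. \<Prod>i=1..k. g i ((x(j := Suc (x j))) i)) \<le>
      (\<Prod>i=1..k. if i = j then ?E (\<lambda>x. g i (Suc (x i))) else ?E (\<lambda>x. g i (x i)))" for j
  proof -
    have "?E (\<lambda>x. \<Prod>i=1..k. g i ((x(j := Suc (x j))) i)) =
        ?E (\<lambda>x. \<Prod>i=1..k. (if i = j then g i \<circ> Suc else g i) (x i))"
      by (intro Bochner_Integration.integral_cong prod.cong refl) auto
    also have "\<dots> \<le> (\<Prod>i=1..k. ?E (\<lambda>x. (if i = j then g i \<circ> Suc else g i) (x i)))"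
      using Suc.prems by (intro Suc.IH) (auto simp: monotone_def)
    also have "\<dots> = (\<Prod>i=1..k. if i = j then ?E (\<lambda>x. g i (Suc (x i))) else ?E (\<lambda>x. g i (x i)))"
      by (intro prod.cong refl) auto
    finally show ?thesis .
  qed
  have "measure_pmf.expectation (multinomial_pmf (Suc n) k p) (\<lambda>x. \<Prod>i=1..k. g i (x i)) \<le>
      (\<Sum>j=1..k. p j *
        (\<Prod>i=1..k. if i = j then ?E (\<lambda>x. g i (Suc (x i))) else ?E (\<lambda>x. g i (x i))))"
    unfolding expectation_multinomial_Suc[OF p]
    by (intro sum_mono mult_left_mono step p0)
  also have "\<dots> \<le> (\<Prod>i=1..k. p i * ?E (\<lambda>x. g i (Suc (x i))) + (1 - p i) * ?E (\<lambda>x. g i (x i)))"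
  proof (rule single_trial_prod_le[OF p])
    show "(\<forall>i\<in>{1..k}. ?E (\<lambda>x. g i (x i)) \<le> ?E (\<lambda>x. g i (Suc (x i)))) \<or>
          (\<forall>i\<in>{1..k}. ?E (\<lambda>x. g i (Suc (x i))) \<le> ?E (\<lambda>x. g i (x i)))"
      using Suc.prems(2)
    proof
      assume "\<forall>i\<in>{1..k}. mono (g i)"
      then show ?thesis by (intro disjI1 ballI integral_mono int) (auto simp: monotone_def)
    next
      assume "\<forall>i\<in>{1..k}. antimono (g i)"
      then show ?thesis by (intro disjI2 ballI integral_mono int) (auto simp: monotone_def)
    qed
  qed (auto intro!: integral_nonneg_AE AE_I2 Suc.prems(1))
  also have "\<dots> = (\<Prod>i=1..k. measure_pmf.expectation (multinomial_pmf (Suc n) k p) (\<lambda>x. g i (x i)))"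
    by (intro prod.cong refl) (simp add: expectation_count_Suc[OF p])
  finally show ?case .
qed

section \<open>Chernoff bounds for one count\<close>

lemma expectation_exp_count_le:
  assumes p: "p \<in> prob_simplex k" and i: "i \<in> {1..k}"
  shows "measure_pmf.expectation (multinomial_pmf n k p) (\<lambda>x. exp (l * real (x i))) \<le>
    exp (real n * p i * (exp l - 1))"
proof (induction n)
  case 0
  then show ?case by (simp add: multinomial_pmf_0)
next
  case (Suc n)
  let ?E = "measure_pmf.expectation (multinomial_pmf n k p) (\<lambda>x. exp (l * real (x i)))"
  have "0 \<le> ?E" by (intro integral_nonneg_AE) auto
  have "measure_pmf.expectation (multinomial_pmf (Suc n) k p) (\<lambda>x. exp (l * real (x i))) =
      (1 + p i * (exp l - 1)) * ?E"
    using expectation_count_Suc[OF p i, of n "\<lambda>y. exp (l * real y)"]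
    by (simp add: distrib_left exp_add algebra_simps)
  also have "\<dots> \<le> exp (p i * (exp l - 1)) * ?E"
    using \<open>0 \<le> ?E\<close> by (intro mult_right_mono exp_ge_add_one_self)
  also have "\<dots> \<le> exp (p i * (exp l - 1)) * exp (real n * p i * (exp l - 1))"
    using Suc by simp
  also have "\<dots> = exp (real (Suc n) * p i * (exp l - 1))"
    by (simp add: algebra_simps flip: exp_add)
  finally show ?case .
qed

text \<open>The Legendre transform at \<open>x\<close> of \<open>l \<mapsto> \<mu> * (exp l - 1)\<close>, the logarithmic moment
  generating function of a Poisson variable with mean \<open>\<mu>\<close>.\<close>

definition poisson_rate :: "real \<Rightarrow> real \<Rightarrow> real" where
  "poisson_rate \<mu> x = x * ln (x / \<mu>) - x + \<mu>"

text \<open>Convexity, as the tangent line at \<open>x\<close>; sign and monotonicity of the rate all follow from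
  it.\<close>

lemma poisson_rate_tangent:
  assumes "0 < \<mu>" "0 < x" "0 \<le> y"
  shows "poisson_rate \<mu> x + (y - x) * ln (x / \<mu>) \<le> poisson_rate \<mu> y"
proof (cases "y = 0")
  case False
  then have y: "0 < y" using assms by simp
  have "y * ln (x / y) \<le> y * (x / y - 1)"
    using y assms by (intro mult_left_mono ln_le_minus_one) auto
  also have "\<dots> = x - y" using y by (simp add: field_simps)
  finally have "y * (ln x - ln y) \<le> x - y" using y assms by (simp add: ln_div)
  then show ?thesis
    using y assms by (simp add: poisson_rate_def ln_div algebra_simps)
qed (use assms in \<open>simp add: poisson_rate_def algebra_simps\<close>)

lemma poisson_rate_self: "0 < \<mu> \<Longrightarrow> poisson_rate \<mu> \<mu> = 0"
  by (simp add: poisson_rate_def)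

lemma poisson_rate_nonneg: "0 < \<mu> \<Longrightarrow> 0 \<le> y \<Longrightarrow> 0 \<le> poisson_rate \<mu> y"
  using poisson_rate_tangent[of \<mu> \<mu> y] by (simp add: poisson_rate_self)

lemma poisson_rate_mono:
  assumes "0 < \<mu>" "\<mu> \<le> x" "x \<le> y"
  shows "poisson_rate \<mu> x \<le> poisson_rate \<mu> y"
proof -
  have "0 \<le> (y - x) * ln (x / \<mu>)" using assms by simp
  then show ?thesis using poisson_rate_tangent[of \<mu> x y] assms by linarith
qed

lemma poisson_rate_antimono:
  assumes "0 < \<mu>" "0 \<le> x" "x \<le> y" "y \<le> \<mu>"
  shows "poisson_rate \<mu> y \<le> poisson_rate \<mu> x"
proof (cases "y = 0")
  case False
  then have "0 \<le> (x - y) * ln (y / \<mu>)"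
    using assms by (intro mult_nonpos_nonpos) auto
  then show ?thesis using poisson_rate_tangent[of \<mu> y x] assms False by linarith
qed (use assms in simp)

text \<open>The two halves of the rate are clamped at the mean, where the rate vanishes. This makes each
  half monotone on all of its domain, as negative dependence requires, while their sum is still
  the full rate.\<close>

definition upper_rate :: "real \<Rightarrow> nat \<Rightarrow> real" where
  "upper_rate \<mu> x = poisson_rate \<mu> (max (real x) \<mu>)"

definition lower_rate :: "real \<Rightarrow> nat \<Rightarrow> real" where
  "lower_rate \<mu> x = poisson_rate \<mu> (min (real x) \<mu>)"

lemma upper_add_lower_rate:
  "0 < \<mu> \<Longrightarrow> upper_rate \<mu> x + lower_rate \<mu> x = poisson_rate \<mu> (real x)"
  by (simp add: upper_rate_def lower_rate_def max_def min_def poisson_rate_self)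

lemma mono_upper_rate: "0 < \<mu> \<Longrightarrow> mono (upper_rate \<mu>)"
  unfolding upper_rate_def by (intro monoI poisson_rate_mono) auto

lemma antimono_lower_rate: "0 < \<mu> \<Longrightarrow> antimono (lower_rate \<mu>)"
  unfolding lower_rate_def by (intro antimonoI poisson_rate_antimono) auto

lemma upper_rate_nonneg: "0 < \<mu> \<Longrightarrow> 0 \<le> upper_rate \<mu> x"
  unfolding upper_rate_def by (intro poisson_rate_nonneg) auto

lemma lower_rate_nonneg: "0 < \<mu> \<Longrightarrow> 0 \<le> lower_rate \<mu> x"
  unfolding lower_rate_def by (intro poisson_rate_nonneg) auto

text \<open>The hypothesis on \<open>A\<close> covers both tails at once: the exponent \<open>ln (y / \<mu>)\<close> is
  positive when \<open>y\<close> lies above the mean and \<open>A\<close> is the event \<open>x i \<ge> y\<close>, and negative for the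
  reversed situation. This exponent is the optimal one for the Poisson bound.\<close>

lemma chernoff_count:
  assumes p: "p \<in> prob_simplex k" and i: "i \<in> {1..k}" and mu: "0 < real n * p i"
    and y: "0 < y"
    and A: "\<And>x. x \<in> A \<Longrightarrow> 0 \<le> (real (x i) - y) * ln (y / (real n * p i))"
  shows "measure_pmf.prob (multinomial_pmf n k p) A \<le> exp (- poisson_rate (real n * p i) y)"
proof -
  let ?M = "multinomial_pmf n k p" and ?l = "ln (y / (real n * p i))"
  note int = integrable_measure_pmf_finite[OF finite_set_pmf_multinomial[OF p]]
  have "measure_pmf.prob ?M A = measure_pmf.expectation ?M (indicator A)"
    by simp
  also have "\<dots> \<le> measure_pmf.expectation ?M (\<lambda>x. exp (- ?l * y) * exp (?l * real (x i)))"
  proof (intro integral_mono int)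
    fix x
    show "indicator A x \<le> exp (- ?l * y) * exp (?l * real (x i))"
      using A[of x] by (auto simp: indicator_def algebra_simps simp flip: exp_add)
  qed
  also have "\<dots> = exp (- ?l * y) * measure_pmf.expectation ?M (\<lambda>x. exp (?l * real (x i)))"
    by simp
  also have "\<dots> \<le> exp (- ?l * y) * exp (real n * p i * (exp ?l - 1))"
    by (intro mult_left_mono expectation_exp_count_le p i) auto
  also have "\<dots> = exp (- poisson_rate (real n * p i) y)"
  proof -
    have "exp ?l = y / (real n * p i)" using y mu by (intro exp_ln divide_pos_pos)
    then have "real n * p i * (exp ?l - 1) = y - real n * p i"
      by (simp only: right_diff_distrib times_divide_eq_right mult_1_right
          nonzero_mult_div_cancel_left[OF less_imp_neq[OF mu, THEN not_sym]])
    then show ?thesis by (simp add: poisson_rate_def algebra_simps flip: exp_add)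
  qed
  finally show ?thesis .
qed

text \<open>The case \<open>y = 0\<close> of the lower Chernoff bound, where the optimal exponent would be minus
  infinity.\<close>

lemma prob_count_zero_le:
  assumes p: "p \<in> prob_simplex k" and i: "i \<in> {1..k}"
  shows "measure_pmf.prob (multinomial_pmf n k p) {x. x i = 0} \<le> exp (- (real n * p i))"
proof (induction n)
  case 0
  then show ?case by simp
next
  case (Suc n)
  let ?g = "\<lambda>y::nat. of_bool (y = 0) :: real"
  have prob: "measure_pmf.prob (multinomial_pmf n k p) {x. x i = 0} =
      measure_pmf.expectation (multinomial_pmf n k p) (\<lambda>x. ?g (x i))" for n
  proof -
    have "(\<lambda>x. ?g (x i)) = indicator {x. x i = 0}" by (auto simp: indicator_def)
    then show ?thesis by simp
  qed
  have "measure_pmf.prob (multinomial_pmf (Suc n) k p) {x. x i = 0} =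
      (1 - p i) * measure_pmf.prob (multinomial_pmf n k p) {x. x i = 0}"
    unfolding prob by (subst expectation_count_Suc[OF p i]) simp
  also have "\<dots> \<le> exp (- p i) * measure_pmf.prob (multinomial_pmf n k p) {x. x i = 0}"
    using exp_ge_add_one_self[of "- p i"] by (intro mult_right_mono) auto
  also have "\<dots> \<le> exp (- p i) * exp (- (real n * p i))"
    using Suc by simp
  also have "\<dots> = exp (- (real (Suc n) * p i))"
    by (simp add: algebra_simps flip: exp_add)
  finally show ?case .
qed

text \<open>By monotonicity the event is \<open>x i \<ge> y\<close> for the least count \<open>y\<close> whose rate reaches \<open>t\<close>,
  and the Chernoff exponent at \<open>y\<close> is that rate.\<close>

lemma upper_rate_tail:
  assumes p: "p \<in> prob_simplex k" and i: "i \<in> {1..k}" and mu: "0 < real n * p i" and t: "0 < t"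
  shows "measure_pmf.prob (multinomial_pmf n k p) {x. t \<le> upper_rate (real n * p i) (x i)} \<le> exp (- t)"
proof (cases "\<exists>y. t \<le> upper_rate (real n * p i) y")
  case True
  define y where "y = (LEAST y. t \<le> upper_rate (real n * p i) y)"
  have y: "t \<le> upper_rate (real n * p i) y"
    unfolding y_def using True by (rule LeastI_ex)
  have least: "y \<le> z" if "t \<le> upper_rate (real n * p i) z" for z
    unfolding y_def using that by (rule Least_le)
  have gt: "real n * p i < real y"
    using y t mu poisson_rate_self[OF mu] by (auto simp: upper_rate_def max_def split: if_splits)
  have "measure_pmf.prob (multinomial_pmf n k p) {x. t \<le> upper_rate (real n * p i) (x i)} \<le>
      exp (- poisson_rate (real n * p i) (real y))"
  proof (rule chernoff_count[OF p i mu])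
    fix x assume "x \<in> {x. t \<le> upper_rate (real n * p i) (x i)}"
    then have "y \<le> x i" using least by auto
    moreover have "0 \<le> ln (real y / (real n * p i))" using gt mu by simp
    ultimately show "0 \<le> (real (x i) - real y) * ln (real y / (real n * p i))" by simp
  qed (use gt mu in linarith)
  also have "\<dots> \<le> exp (- t)"
    using y gt by (simp add: upper_rate_def max_def)
  finally show ?thesis .
qed simp

lemma lower_rate_tail:
  assumes p: "p \<in> prob_simplex k" and i: "i \<in> {1..k}" and mu: "0 < real n * p i" and t: "0 < t"
  shows "measure_pmf.prob (multinomial_pmf n k p) {x. t \<le> lower_rate (real n * p i) (x i)} \<le> exp (- t)"
proof (cases "\<exists>y. t \<le> lower_rate (real n * p i) y")
  case True
  have lt: "real y < real n * p i" if "t \<le> lower_rate (real n * p i) y" for y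
  proof (rule ccontr)
    assume "\<not> real y < real n * p i"
    then have "lower_rate (real n * p i) y = 0"
      using poisson_rate_self[OF mu] by (simp add: lower_rate_def min_absorb2)
    then show False using that t by simp
  qed
  have bdd: "y \<le> nat \<lceil>real n * p i\<rceil>" if "t \<le> lower_rate (real n * p i) y" for y
    using lt[OF that] by linarith
  define y where "y = (GREATEST y. t \<le> lower_rate (real n * p i) y)"
  have y: "t \<le> lower_rate (real n * p i) y"
    unfolding y_def using True bdd by (metis (mono_tags, lifting) GreatestI_ex_nat)
  have greatest: "z \<le> y" if "t \<le> lower_rate (real n * p i) z" for z
    unfolding y_def using that bdd by (rule Greatest_le_nat)
  have ty: "t \<le> poisson_rate (real n * p i) (real y)"
    using y lt[OF y] by (simp add: lower_rate_def min_def)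
  have "measure_pmf.prob (multinomial_pmf n k p) {x. t \<le> lower_rate (real n * p i) (x i)} \<le>
      exp (- poisson_rate (real n * p i) (real y))"
  proof (cases "y = 0")
    case True
    have "measure_pmf.prob (multinomial_pmf n k p) {x. t \<le> lower_rate (real n * p i) (x i)} \<le>
        measure_pmf.prob (multinomial_pmf n k p) {x. x i = 0}"
      using greatest True by (intro measure_pmf.finite_measure_mono) auto
    then show ?thesis
      using prob_count_zero_le[OF p i, of n] True by (simp add: poisson_rate_def)
  next
    case False
    show ?thesis
    proof (rule chernoff_count[OF p i mu])
      fix x assume "x \<in> {x. t \<le> lower_rate (real n * p i) (x i)}"
      then have "x i \<le> y" using greatest by auto
      moreover have "ln (real y / (real n * p i)) \<le> 0" using lt[OF y] mu False by simp
      ultimately show "0 \<le> (real (x i) - real y) * ln (real y / (real n * p i))"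
        by (intro mult_nonpos_nonpos) auto
    qed (use False in simp)
  qed
  also have "\<dots> \<le> exp (- t)" using ty by simp
  finally show ?thesis .
qed simp

section \<open>From tails to moment generating functions and back\<close>

text \<open>Slicing the range of \<open>Y\<close> at the integers bounds the expectation by the geometric series
  \<open>\<Sum>j. exp ((j + 1) / 2) * exp (- j)\<close>.\<close>

lemma expectation_exp_half_le:
  fixes Y :: "'a \<Rightarrow> real"
  assumes fin: "finite (set_pmf M)"
    and Y: "\<And>x. 0 \<le> Y x"
    and tail: "\<And>t. 0 < t \<Longrightarrow> measure_pmf.prob M {x. t \<le> Y x} \<le> exp (- t)"
  shows "measure_pmf.expectation M (\<lambda>x. exp (Y x / 2)) \<le> 6"
proof -
  note int = integrable_measure_pmf_finite[OF fin]
  obtain N :: nat where N: "\<And>x. x \<in> set_pmf M \<Longrightarrow> Y x < real N"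
  proof -
    obtain N where "Max (insert 0 (Y ` set_pmf M)) < real N" using reals_Archimedean2 by blast
    then show ?thesis using that fin by auto
  qed
  define q :: real where "q = exp (- (1 / 2))"
  have pt: "exp (Y x / 2) \<le> (\<Sum>j<N. exp ((real j + 1) / 2) * indicator {x. real j \<le> Y x} x)"
    if x: "x \<in> set_pmf M" for x
  proof -
    define j where "j = nat \<lfloor>Y x\<rfloor>"
    have j: "real j \<le> Y x" "Y x < real j + 1" using Y[of x] by (auto simp: j_def)
    have "j < N" using N[OF x] j by linarith
    have "exp (Y x / 2) \<le> exp ((real j + 1) / 2) * indicator {x. real j \<le> Y x} x"
      using j by simp
    also have "\<dots> \<le> (\<Sum>j<N. exp ((real j + 1) / 2) * indicator {x. real j \<le> Y x} x)"
      using \<open>j < N\<close> by (intro member_le_sum) auto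
    finally show ?thesis .
  qed
  have tail0: "measure_pmf.prob M {x. real j \<le> Y x} \<le> exp (- real j)" for j
    using tail[of "real j"] by (cases "j = 0") auto
  have "measure_pmf.expectation M (\<lambda>x. exp (Y x / 2)) \<le>
      measure_pmf.expectation M (\<lambda>x. \<Sum>j<N. exp ((real j + 1) / 2) * indicator {x. real j \<le> Y x} x)"
    using pt by (intro integral_mono_AE int) (auto simp: AE_measure_pmf_iff)
  also have "\<dots> = (\<Sum>j<N. exp ((real j + 1) / 2) * measure_pmf.prob M {x. real j \<le> Y x})"
    by (subst Bochner_Integration.integral_sum) (auto intro!: int)
  also have "\<dots> \<le> (\<Sum>j<N. exp ((real j + 1) / 2) * exp (- real j))"
    by (intro sum_mono mult_left_mono tail0) auto
  also have "\<dots> = (\<Sum>j<N. exp (1 / 2) * q ^ j)"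
  proof (rule sum.cong[OF refl])
    fix j
    have "q ^ j = exp (- (real j / 2))" unfolding q_def by (simp flip: exp_of_nat_mult)
    then show "exp ((real j + 1) / 2) * exp (- real j) = exp (1 / 2) * q ^ j"
      by (simp add: field_simps flip: exp_add)
  qed
  also have "\<dots> = exp (1 / 2) * ((1 - q ^ N) / (1 - q))"
    by (simp add: sum_gp_strict q_def flip: sum_distrib_left)
  also have "\<dots> \<le> 2 * 3"
  proof (rule mult_mono)
    have q0: "0 < q" by (simp add: q_def)
    have inv: "exp (1 / 2) * q = 1" by (simp add: q_def flip: exp_add)
    have "exp (1 / 2) * (1 / 2) \<le> exp (1 / 2) * q"
      unfolding q_def using exp_ge_add_one_self[of "- (1 / 2)::real"] by (intro mult_left_mono) auto
    then show "exp (1 / 2) \<le> (2::real)" unfolding inv by simp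
    have "3 / 2 * q \<le> exp (1 / 2) * q"
      using q0 exp_ge_add_one_self[of "1 / 2::real"] by (intro mult_right_mono) auto
    then have q1: "q \<le> 2 / 3" unfolding inv by simp
    have "(1 - q ^ N) / (1 - q) \<le> 1 / (1 - q)" using q0 q1 by (intro divide_right_mono) auto
    also have "\<dots> \<le> 3" using q1 by (simp add: field_simps)
    finally show "(1 - q ^ N) / (1 - q) \<le> 3" .
    show "0 \<le> (1 - q ^ N) / (1 - q)" using q0 q1 by (auto intro!: divide_nonneg_pos power_le_one)
  qed simp
  finally show ?thesis by simp
qed

text \<open>The number is \<open>64 * 6 * exp (5 / 2)\<close>; its three factors come from the second-order
  remainder, from the exponential moment of \<open>Y\<close>, and from the bound \<open>10\<close> on the mean of
  \<open>Y\<close>, respectively.\<close>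

definition centred_mgf_const :: real where
  "centred_mgf_const = 384 * exp (5 / 2)"

lemma centred_mgf_const_pos: "0 < centred_mgf_const"
  by (simp add: centred_mgf_const_def)

lemma exp_le_quadratic:
  fixes x :: real
  shows "exp x \<le> 1 + x + x\<^sup>2 / 2 * exp \<bar>x\<bar>"
proof -
  obtain t where t: "\<bar>t\<bar> \<le> \<bar>x\<bar>" "exp x = (\<Sum>m<2. x ^ m / fact m) + exp t / fact 2 * x ^ 2"
    using Maclaurin_exp_le[of x 2] by auto
  have "exp t * x\<^sup>2 \<le> exp \<bar>x\<bar> * x\<^sup>2" using t(1) by (intro mult_right_mono) auto
  then show ?thesis using t(2) by (simp add: numeral_2_eq_2 mult_ac)
qed

text \<open>Centring kills the first-order term of the exponential; the second-order remainder is
  controlled by the exponential moment of \<open>Y\<close>, with room to spare for the factor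
  \<open>(Y - e)\<^sup>2\<close> since \<open>s\<close> is small. Nonnegativity of \<open>Y\<close> gives the bound on its mean \<open>e\<close>.\<close>

lemma centred_mgf_le:
  fixes Y :: "'a \<Rightarrow> real"
  assumes fin: "finite (set_pmf M)"
    and Y: "\<And>x. 0 \<le> Y x"
    and half: "measure_pmf.expectation M (\<lambda>x. exp (Y x / 2)) \<le> 6"
    and s: "\<bar>s\<bar> \<le> 1 / 8"
  shows "measure_pmf.expectation M (\<lambda>x. exp (s * (Y x - measure_pmf.expectation M Y))) \<le>
    exp (centred_mgf_const * s\<^sup>2)"
proof -
  note int = integrable_measure_pmf_finite[OF fin]
  let ?E = "measure_pmf.expectation M"
  define e where "e = ?E Y"
  have e0: "0 \<le> e" unfolding e_def using Y by (intro integral_nonneg_AE) auto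
  have "?E (\<lambda>x. 1 + Y x / 2) \<le> ?E (\<lambda>x. exp (Y x / 2))"
    by (intro integral_mono int) (rule exp_ge_add_one_self)
  then have e10: "e \<le> 10"
    using half by (simp add: e_def int)
  have pt: "exp (s * (Y x - e)) \<le> 1 + s * (Y x - e) + 64 * exp (5 / 2) * s\<^sup>2 * exp (Y x / 2)" for x
  proof -
    define W where "W = \<bar>Y x - e\<bar>"
    have W0: "0 \<le> W" by (simp add: W_def)
    (* One factor exp (W / 8) pays for W^2 and the other for the remainder; together they leave
       exp (W / 4), which is integrable with W \<le> Y + 10. *)
    have "(W / 8)\<^sup>2 / 2 \<le> exp (W / 8)"
      using exp_lower_Taylor_quadratic[of "W / 8"] W0 by simp
    then have W2: "W\<^sup>2 \<le> 128 * exp (W / 8)"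
      by (simp add: power2_eq_square)
    have "\<bar>s * (Y x - e)\<bar> \<le> 1 / 8 * W"
      unfolding W_def abs_mult using s by (intro mult_right_mono) auto
    then have "exp \<bar>s * (Y x - e)\<bar> \<le> exp (W / 8)" by simp
    then have "W\<^sup>2 * exp \<bar>s * (Y x - e)\<bar> \<le> 128 * exp (W / 8) * exp (W / 8)"
      using W2 by (intro mult_mono) auto
    also have "\<dots> = 128 * exp (W / 4)" by (simp flip: exp_add)
    also have "\<dots> \<le> 128 * exp (5 / 2 + Y x / 2)"
      using Y[of x] e0 e10 by (simp add: W_def)
    finally have "s\<^sup>2 / 2 * (W\<^sup>2 * exp \<bar>s * (Y x - e)\<bar>) \<le> s\<^sup>2 / 2 * (128 * exp (5 / 2 + Y x / 2))"
      by (rule mult_left_mono) simp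
    moreover have "(s * (Y x - e))\<^sup>2 / 2 * exp \<bar>s * (Y x - e)\<bar> =
        s\<^sup>2 / 2 * (W\<^sup>2 * exp \<bar>s * (Y x - e)\<bar>)"
      by (simp add: W_def power_mult_distrib)
    ultimately show ?thesis
      using exp_le_quadratic[of "s * (Y x - e)"] by (simp add: exp_add algebra_simps)
  qed
  have "?E (\<lambda>x. exp (s * (Y x - e))) \<le>
      ?E (\<lambda>x. 1 + s * (Y x - e) + 64 * exp (5 / 2) * s\<^sup>2 * exp (Y x / 2))"
    by (intro integral_mono int pt)
  also have "\<dots> = 1 + 64 * exp (5 / 2) * s\<^sup>2 * ?E (\<lambda>x. exp (Y x / 2))"
    by (simp add: int e_def)
  also have "\<dots> \<le> 1 + 64 * exp (5 / 2) * s\<^sup>2 * 6"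
    using half by (intro add_left_mono mult_left_mono) auto
  also have "\<dots> \<le> exp (centred_mgf_const * s\<^sup>2)"
    using exp_ge_add_one_self[of "centred_mgf_const * s\<^sup>2"]
    by (simp add: centred_mgf_const_def mult.assoc)
  finally show ?thesis by (simp add: e_def)
qed

text \<open>The elementary bound \<open>\<bar>y\<bar> ^ m \<le> (m / s) ^ m * exp (s * \<bar>y\<bar>)\<close> gives a norm of order
  \<open>m / s\<close>, up to the factor \<open>exp (B * k * s\<^sup>2 / m)\<close>. The largest admissible \<open>s\<close>
  for which this factor stays bounded is of order \<open>sqrt (m / k)\<close>, truncated at \<open>c\<close>.\<close>

lemma moment_norm_le_of_mgf:
  fixes A :: "'a \<Rightarrow> real"
  assumes fin: "finite (set_pmf M)" and k: "0 < k" and B: "0 \<le> B" and c: "0 < c" and m: "1 \<le> m"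
    and mgf: "\<And>s. \<bar>s\<bar> \<le> c \<Longrightarrow> measure_pmf.expectation M (\<lambda>x. exp (s * A x)) \<le> exp (B * k * s\<^sup>2)"
  shows "moment_norm (measure_pmf M) m A \<le> 2 * exp B * (sqrt (k * real m) + real m / c)"
proof -
  note int = integrable_measure_pmf_finite[OF fin]
  let ?E = "measure_pmf.expectation M"
  define s where "s = min c (sqrt (real m / k))"
  have s: "0 < s" "s \<le> c" using k m c by (auto simp: s_def)
  have "s\<^sup>2 \<le> (sqrt (real m / k))\<^sup>2" using s by (intro power_mono) (auto simp: s_def)
  then have "k * s\<^sup>2 \<le> real m" using k by (simp add: field_simps)
  then have "B * k * s\<^sup>2 \<le> B * real m" using B by (simp add: mult_left_mono mult.assoc)
  then have mgf': "?E (\<lambda>x. exp (\<sigma> * A x)) \<le> exp (B * real m)" if "\<bar>\<sigma>\<bar> = s" for \<sigma>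
  proof -
    have "\<sigma>\<^sup>2 = s\<^sup>2" using that power2_abs[of \<sigma>] by simp
    then show ?thesis
      using mgf[of \<sigma>] \<open>B * k * s\<^sup>2 \<le> B * real m\<close> that s(2)
      by (simp add: order_trans)
  qed
  have pt: "\<bar>A x\<bar> ^ m \<le> (real m / s) ^ m * (exp (s * A x) + exp (- s * A x))" for x
  proof -
    have "(s * \<bar>A x\<bar> / real m) ^ m \<le> exp (s * \<bar>A x\<bar> / real m) ^ m"
    proof (intro power_mono)
      show "s * \<bar>A x\<bar> / real m \<le> exp (s * \<bar>A x\<bar> / real m)"
        using exp_ge_add_one_self[of "s * \<bar>A x\<bar> / real m"] by linarith
    qed (use s in simp)
    also have "\<dots> = exp (s * \<bar>A x\<bar>)"
      using m by (simp flip: exp_of_nat_mult)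
    also have "\<dots> \<le> exp (s * A x) + exp (- s * A x)"
      by (cases "0 \<le> A x") auto
    finally have "(real m / s) ^ m * (s * \<bar>A x\<bar> / real m) ^ m \<le>
        (real m / s) ^ m * (exp (s * A x) + exp (- s * A x))"
      using s by (intro mult_left_mono) auto
    moreover have "(real m / s) ^ m * (s * \<bar>A x\<bar> / real m) ^ m = \<bar>A x\<bar> ^ m"
      using s m by (simp flip: power_mult_distrib)
    ultimately show ?thesis by simp
  qed
  have "?E (\<lambda>x. \<bar>A x\<bar> ^ m) \<le> ?E (\<lambda>x. (real m / s) ^ m * (exp (s * A x) + exp (- s * A x)))"
    by (intro integral_mono int pt)
  also have "\<dots> = (real m / s) ^ m * (?E (\<lambda>x. exp (s * A x)) + ?E (\<lambda>x. exp (- s * A x)))"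
    by (simp add: int)
  also have "\<dots> \<le> (real m / s) ^ m * (2 * exp (B * real m))"
    using mgf'[of s] mgf'[of "- s"] s by (intro mult_left_mono) auto
  also have "\<dots> \<le> (real m / s) ^ m * (2 ^ m * exp (B * real m))"
    using s m self_le_power[of 2 m] by (intro mult_left_mono mult_right_mono) auto
  also have "\<dots> = (2 * exp B * (real m / s)) ^ m"
  proof -
    have "exp (B * real m) = exp B ^ m" by (simp add: mult.commute flip: exp_of_nat_mult)
    then show ?thesis by (simp only: power_mult_distrib mult_ac)
  qed
  finally have "moment_norm (measure_pmf M) m A \<le> ((2 * exp B * (real m / s)) ^ m) powr (1 / real m)"
    unfolding moment_norm_def by (intro powr_mono2 integral_nonneg_AE) auto
  also have "\<dots> = 2 * exp B * (real m / s)"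
    using s m by (simp add: powr_powr flip: powr_realpow)
  also have "real m / s \<le> sqrt (k * real m) + real m / c"
  proof (cases "c \<le> sqrt (real m / k)")
    case True
    then show ?thesis using k by (simp add: s_def)
  next
    case False
    then have "s = sqrt (real m / k)" by (simp add: s_def)
    moreover have "sqrt (k * real m) * sqrt (real m / k) = real m"
      using k by (simp flip: real_sqrt_mult)
    ultimately have "sqrt (k * real m) * s = real m" by (simp only:)
    then have "real m / s = sqrt (k * real m)"
      using s(1) by (metis less_irrefl nonzero_mult_div_cancel_right)
    then show ?thesis using c by simp
  qed
  finally show ?thesis by simp
qed

section \<open>Concentration of the relative entropy\<close>

text \<open>For either sign of \<open>s\<close> the functions \<open>exp (s * f i)\<close> are again all increasing or all
  decreasing, so negative dependence reduces both tails of the sum to single counts.\<close>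

lemma multinomial_centred_mgf_le:
  fixes f :: "nat \<Rightarrow> nat \<Rightarrow> real"
  assumes p: "p \<in> prob_simplex k"
    and f: "\<And>i y. i \<in> {1..k} \<Longrightarrow> 0 \<le> f i y"
    and mon: "(\<forall>i\<in>{1..k}. mono (f i)) \<or> (\<forall>i\<in>{1..k}. antimono (f i))"
    and tail: "\<And>i t. i \<in> {1..k} \<Longrightarrow> 0 < t \<Longrightarrow>
      measure_pmf.prob (multinomial_pmf n k p) {x. t \<le> f i (x i)} \<le> exp (- t)"
    and s: "\<bar>s\<bar> \<le> 1 / 8"
  shows "measure_pmf.expectation (multinomial_pmf n k p)
      (\<lambda>x. exp (s * (\<Sum>i=1..k. f i (x i) -
        measure_pmf.expectation (multinomial_pmf n k p) (\<lambda>x. f i (x i))))) \<le>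
    exp (centred_mgf_const * real k * s\<^sup>2)"
proof -
  let ?M = "multinomial_pmf n k p"
  let ?E = "measure_pmf.expectation ?M"
  note fin = finite_set_pmf_multinomial[OF p]
  define g where "g i y = exp (s * (f i y - ?E (\<lambda>x. f i (x i))))" for i y
  have mon_g: "(\<forall>i\<in>{1..k}. mono (g i)) \<or> (\<forall>i\<in>{1..k}. antimono (g i))"
  proof (cases "0 \<le> s")
    case True
    then show ?thesis using mon
      by (auto simp: monotone_def g_def mult_left_mono)
  next
    case False
    then show ?thesis using mon
      by (auto simp: monotone_def g_def mult_left_mono_neg)
  qed
  have "?E (\<lambda>x. exp (s * (\<Sum>i=1..k. f i (x i) - ?E (\<lambda>x. f i (x i))))) = ?E (\<lambda>x. \<Prod>i=1..k. g i (x i))"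
    by (simp add: g_def sum_distrib_left exp_sum)
  also have "\<dots> \<le> (\<Prod>i=1..k. ?E (\<lambda>x. g i (x i)))"
    by (rule multinomial_expectation_prod_le[OF p _ mon_g]) (simp add: g_def)
  also have "\<dots> \<le> (\<Prod>i=1..k. exp (centred_mgf_const * s\<^sup>2))"
  proof (rule prod_mono, rule conjI)
    fix i assume i: "i \<in> {1..k}"
    show "0 \<le> ?E (\<lambda>x. g i (x i))" by (intro integral_nonneg_AE) (simp add: g_def)
    show "?E (\<lambda>x. g i (x i)) \<le> exp (centred_mgf_const * s\<^sup>2)"
      unfolding g_def
      by (intro centred_mgf_le[OF fin] expectation_exp_half_le[OF fin] tail f i s)
  qed
  also have "\<dots> = exp (centred_mgf_const * real k * s\<^sup>2)"
    by (simp add: mult_ac flip: exp_of_nat_mult)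
  finally show ?thesis .
qed

text \<open>The linear terms of the rates cancel because counts and means have the same total.\<close>

lemma Z_eq_sum_poisson_rate:
  assumes p: "p \<in> prob_simplex k" and n: "1 \<le> n"
    and x: "x \<in> set_pmf (multinomial_pmf n k p)"
  shows "Z n k p x = 2 * (\<Sum>i=1..k. poisson_rate (real n * p i) (real (x i)))"
proof -
  have "(\<Sum>i=1..k. real (x i)) = real n"
    using sum_counts_multinomial[OF p x] by (metis of_nat_sum)
  moreover have "(\<Sum>i=1..k. real n * p i) = real n"
    using p by (simp add: prob_simplex_def flip: sum_distrib_left)
  moreover have "(\<Sum>i=1..k. poisson_rate (real n * p i) (real (x i))) =
      (\<Sum>i=1..k. real (x i) * ln (real (x i) / (real n * p i)))
        - (\<Sum>i=1..k. real (x i)) + (\<Sum>i=1..k. real n * p i)"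
    by (simp add: poisson_rate_def sum.distrib sum_subtractf)
  ultimately have "(\<Sum>i=1..k. poisson_rate (real n * p i) (real (x i))) =
      (\<Sum>i=1..k. real (x i) * ln (real (x i) / (real n * p i)))"
    by linarith
  then show ?thesis
    using n by (simp add: Z_def rel_entropy_def empirical_def sum_distrib_left)
qed

text \<open>The upper and lower parts are monotone in opposite directions, so negative dependence does
  not apply to them jointly. They are separated by \<open>exp (a + b) \<le> (exp (2 * a) + exp (2 * b)) / 2\<close>,
  which together with the factor \<open>2\<close> in \<open>Z\<close> replaces \<open>s\<close> by \<open>4 * s\<close>.\<close>

lemma Z_centred_mgf_le:
  assumes p: "p \<in> prob_simplex k" and pos: "\<And>i. i \<in> {1..k} \<Longrightarrow> 0 < p i" and n: "1 \<le> n"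
    and s: "\<bar>s\<bar> \<le> 1 / 32"
  shows "measure_pmf.expectation (multinomial_pmf n k p)
      (\<lambda>x. exp (s * (Z n k p x - measure_pmf.expectation (multinomial_pmf n k p) (Z n k p)))) \<le>
    exp (16 * centred_mgf_const * real k * s\<^sup>2)"
proof -
  let ?M = "multinomial_pmf n k p"
  let ?E = "measure_pmf.expectation ?M"
  note int = integrable_measure_pmf_finite[OF finite_set_pmf_multinomial[OF p]]
  define dev where "dev f x = (\<Sum>i=1..k. f (real n * p i) (x i) - ?E (\<lambda>x. f (real n * p i) (x i)))"
    for f :: "real \<Rightarrow> nat \<Rightarrow> real" and x
  have mu: "0 < real n * p i" if "i \<in> {1..k}" for i
    using pos[OF that] n by simp
  have Z: "Z n k p x = 2 * (\<Sum>i=1..k. upper_rate (real n * p i) (x i) + lower_rate (real n * p i) (x i))"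
    if "x \<in> set_pmf ?M" for x
    unfolding Z_eq_sum_poisson_rate[OF p n that]
    by (intro arg_cong[where f = "\<lambda>y. 2 * y"] sum.cong refl) (simp add: upper_add_lower_rate mu)
  have "?E (Z n k p) =
      ?E (\<lambda>x. 2 * (\<Sum>i=1..k. upper_rate (real n * p i) (x i) + lower_rate (real n * p i) (x i)))"
    by (intro integral_cong_AE) (auto simp: AE_measure_pmf_iff Z)
  also have "\<dots> = 2 * (\<Sum>i=1..k. ?E (\<lambda>x. upper_rate (real n * p i) (x i)) +
      ?E (\<lambda>x. lower_rate (real n * p i) (x i)))"
    by (simp add: int Bochner_Integration.integral_sum Bochner_Integration.integral_add)
  finally have Zdev: "Z n k p x - ?E (Z n k p) = 2 * (dev upper_rate x + dev lower_rate x)"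
    if "x \<in> set_pmf ?M" for x
    unfolding Z[OF that] dev_def by (simp add: sum.distrib sum_subtractf algebra_simps)
  have am_gm: "exp (a + b) \<le> (exp (2 * a) + exp (2 * b)) / 2" for a b :: real
    using sum_squares_bound[of "exp a" "exp b"]
    unfolding exp_add exp_double by (simp add: mult_ac)
  have s4: "\<bar>4 * s\<bar> \<le> 1 / 8" using s by simp
  have up: "?E (\<lambda>x. exp (4 * s * dev upper_rate x)) \<le> exp (centred_mgf_const * real k * (4 * s)\<^sup>2)"
    unfolding dev_def
    by (rule multinomial_centred_mgf_le[OF p _ _ _ s4])
      (intro upper_rate_nonneg disjI1 ballI mono_upper_rate upper_rate_tail[OF p] mu; assumption)+
  have low: "?E (\<lambda>x. exp (4 * s * dev lower_rate x)) \<le> exp (centred_mgf_const * real k * (4 * s)\<^sup>2)"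
    unfolding dev_def
    by (rule multinomial_centred_mgf_le[OF p _ _ _ s4])
      (intro lower_rate_nonneg disjI2 ballI antimono_lower_rate lower_rate_tail[OF p] mu; assumption)+
  have "?E (\<lambda>x. exp (s * (Z n k p x - ?E (Z n k p)))) \<le>
      ?E (\<lambda>x. (exp (4 * s * dev upper_rate x) + exp (4 * s * dev lower_rate x)) / 2)"
  proof (intro integral_mono_AE int, unfold AE_measure_pmf_iff, intro ballI)
    fix x assume x: "x \<in> set_pmf ?M"
    show "exp (s * (Z n k p x - ?E (Z n k p))) \<le>
        (exp (4 * s * dev upper_rate x) + exp (4 * s * dev lower_rate x)) / 2"
      unfolding Zdev[OF x]
      using am_gm[of "2 * s * dev upper_rate x" "2 * s * dev lower_rate x"]
      by (simp add: algebra_simps)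
  qed
  also have "\<dots> = (?E (\<lambda>x. exp (4 * s * dev upper_rate x)) + ?E (\<lambda>x. exp (4 * s * dev lower_rate x))) / 2"
    by (simp add: int)
  also have "\<dots> \<le> exp (centred_mgf_const * real k * (4 * s)\<^sup>2)"
    using up low by simp
  finally show ?thesis by (simp add: power_mult_distrib mult_ac)
qed

lemma prob_simplex_ge_le:
  assumes "p \<in> prob_simplex_ge k \<alpha>" "i \<in> {1..k}"
  shows "\<alpha> \<le> p i"
  using assms Min_le[of "p ` {1..k}" "p i"] by (auto simp: prob_simplex_ge_def)

text \<open>All \<open>k \<ge> 2\<close> masses are at least \<open>\<alpha>\<close>, so \<open>\<alpha> \<le> 1 / 2\<close> and \<open>k / \<alpha> \<ge> 4 > exp 1\<close>.\<close>

lemma ln_ratio_ge_1: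
  assumes k: "2 \<le> k" and \<alpha>: "0 < \<alpha>" and p: "p \<in> prob_simplex_ge k \<alpha>"
  shows "1 \<le> ln (real k / \<alpha>)"
proof -
  have "real k * \<alpha> \<le> (\<Sum>i=1..k. p i)"
    using sum_mono[OF prob_simplex_ge_le[OF p], of "{1..k}"] by simp
  then have "real k * \<alpha> \<le> 1" using p by (simp add: prob_simplex_ge_def prob_simplex_def)
  moreover have "2 * \<alpha> \<le> real k * \<alpha>" using k \<alpha> by (intro mult_right_mono) auto
  ultimately have "3 * \<alpha> \<le> real k" using k by linarith
  then have "3 \<le> real k / \<alpha>" using \<alpha> by (simp add: field_simps)
  then have "exp 1 \<le> real k / \<alpha>" using exp_le by linarith
  then show ?thesis using k \<alpha> by (subst ln_ge_iff) auto
qed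

theorem corollary2:
  shows "\<exists>K::real. K > 0 \<and>
    (\<forall>(n::nat) (k::nat) (\<alpha>::real) (p::nat \<Rightarrow> real) (m::nat).
       n \<ge> 1 \<longrightarrow> k \<ge> 2 \<longrightarrow> \<alpha> > 0 \<longrightarrow> p \<in> prob_simplex_ge k \<alpha> \<longrightarrow> m \<ge> 1 \<longrightarrow>
       moment_norm (measure_pmf (multinomial_pmf n k p)) m
         (\<lambda>x. Z n k p x - measure_pmf.expectation (multinomial_pmf n k p) (Z n k p))
       \<le> K * (sqrt (real k * real m * ln (real k / \<alpha>) ^ 4) + real m))"
proof -
  define B where "B = 16 * centred_mgf_const"
  have B: "0 \<le> B" using centred_mgf_const_pos by (simp add: B_def)
  have "moment_norm (measure_pmf (multinomial_pmf n k p)) m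
      (\<lambda>x. Z n k p x - measure_pmf.expectation (multinomial_pmf n k p) (Z n k p))
      \<le> 64 * exp B * (sqrt (real k * real m * ln (real k / \<alpha>) ^ 4) + real m)"
    if n: "1 \<le> n" and k: "2 \<le> k" and \<alpha>: "0 < \<alpha>" and p: "p \<in> prob_simplex_ge k \<alpha>" and m: "1 \<le> m"
    for n k m :: nat and \<alpha> :: real and p :: "nat \<Rightarrow> real"
  proof -
    have ps: "p \<in> prob_simplex k" using p by (simp add: prob_simplex_ge_def)
    have pos: "0 < p i" if "i \<in> {1..k}" for i
      using prob_simplex_ge_le[OF p that] \<alpha> by linarith
    have "moment_norm (measure_pmf (multinomial_pmf n k p)) m
        (\<lambda>x. Z n k p x - measure_pmf.expectation (multinomial_pmf n k p) (Z n k p))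
        \<le> 2 * exp B * (sqrt (real k * real m) + real m / (1 / 32))"
      using k B m Z_centred_mgf_le[OF ps pos n]
      by (intro moment_norm_le_of_mgf finite_set_pmf_multinomial ps) (auto simp: B_def)
    also have "\<dots> \<le> 64 * exp B * (sqrt (real k * real m) + real m)"
      by (simp add: algebra_simps)
    also have "\<dots> \<le> 64 * exp B * (sqrt (real k * real m * ln (real k / \<alpha>) ^ 4) + real m)"
    proof (intro mult_left_mono add_right_mono real_sqrt_le_mono)
      have "1 \<le> ln (real k / \<alpha>) ^ 4"
        using ln_ratio_ge_1[OF k \<alpha> p] by (rule one_le_power)
      then show "real k * real m \<le> real k * real m * ln (real k / \<alpha>) ^ 4"
        using mult_left_mono[of 1 "ln (real k / \<alpha>) ^ 4" "real k * real m"] by simp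
    qed simp
    finally show ?thesis .
  qed
  then show ?thesis by (intro exI[of _ "64 * exp B"]) simp
qed

end
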